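(* Infinite Betten-Walker spreads are not algebraic sets of lines. That is: let $K$ be an infinite commutative field with $\operatorname{Char}K\neq 3$ such that each element of $K$ has precisely one third root in $K$. Then the Betten-Walker spread $\mathcal{O}$ of $\mathbb{P}_3(K)$ is not an algebraic set of lines.
   Context: Points of the projective space $\mathbb{P}_3(K)$ are the one-dimensional subspaces $K\mathbf{p}$ with $0\neq\mathbf{p}=(p_0,p_1,p_2,p_3)^{T}\in K^{4\times1}$; similarly for $\mathbb{P}_5(K)$ with $K^{6\times 1}$. For homogeneous polynomials $g_1,\dots,g_r$ over $K$, $\mathcal{V}(g_1,\dots,g_r)$ denotes the set of ($K$-rational) points at which $g_1,\dots,g_r$ all vanish, in $\mathbb{P}_3(K)$ for polynomials in $X_0,\dots,X_3$ and in $\mathbb{P}_5(K)$ for polynomials in $Y_{01},Y_{02},Y_{03},Y_{12},Y_{13},Y_{23}$. Put $f:=X_0X_1X_2-X_1^3-X_0^2X_3$ and let $F=\mathcal{V}(f)\subset\mathbb{P}_3(K)$ be the Cayley surface; let $g_\infty=\mathcal{V}(X_0,X_1)$. A point of $F$ is simple if not all the partial derivatives $\partial f/\partial X_i$ vanish there. The simple points of $F$ are exactly the points of $F$ outside the plane $\mathcal{V}(X_0)$, namely $P(u_1,u_2)=K(1,u_1,u_2,u_1u_2-u_1^3)^T$ with $(u_1,u_2)\in K^2$. A generator of $F$ is one of the lines spanned by $K(s_0^2,s_0s_1,s_1^2,0)^T$ and $K(0,0,s_0,s_1)^T$, with $(s_0,s_1)\in K^2\setminus\{(0,0)\}$; these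 are the lines contained in $F$. A line $t$ is an osculating tangent of $F$ at a simple point $P=K\mathbf{p}$ if it meets $F$ at $P$ with multiplicity $\geq 3$: for $t=K\mathbf{p}+K\mathbf{q}$ the polynomial $f(\mathbf{p}+T\mathbf{q})\in K[T]$ is divisible by $T^3$ (possibly zero). A proper osculating tangent of $F$ is an osculating tangent at some simple point that is not a generator of $F$. Let $\mathcal{O}$ be the set of lines consisting of all proper osculating tangents of $F$ together with $g_\infty$. If $\operatorname{Char}K\neq3$ and each element of $K$ has precisely one third root in $K$, then $\mathcal{O}$ is a spread (each point of $\mathbb{P}_3(K)$ is on exactly one line of $\mathcal{O}$), called the Betten-Walker spread over $K$; it is infinite when $K$ is infinite. The Klein mapping $\kappa$ sends a line $K\mathbf{p}+K\mathbf{q}$ of $\mathbb{P}_3(K)$ to the point $K(y_{01},y_{02},y_{03},y_{12},y_{13},y_{23})^T$ of $\mathbb{P}_5(K)$, where $y_{ij}=p_iq_j-p_jq_i$ (Plücker coordinates). A set of lines of $\mathbb{P}_3(K)$ is algebraic if its image under $\kappa$ is the set of $K$-rational points of an algebraic variety in $\mathbb{P}_5(K)$, i.e. equals $\mathcal{V}(g_1,\dots,g_r)$ for some homogeneous polynomials $g_1,\dots,g_r\in K[Y_{01},\dots,Y_{23}]$. *)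

theory Defs
  imports
    "HOL-Analysis.Analysis"
    "HOL-Library.Poly_Mapping"
begin

text \<open>
  Polynomials in variables indexed by \<open>'v\<close> are finitely supported maps from exponent vectors
  to coefficients; the ring structure is the convolution product of \<open>Poly_Mapping\<close>.
\<close>

type_synonym ('v, 'a) mpoly = "('v \<Rightarrow>\<^sub>0 nat) \<Rightarrow>\<^sub>0 'a"

definition Var :: "'v \<Rightarrow> ('v, 'a::comm_semiring_1) mpoly" where
  "Var i = Poly_Mapping.single (Poly_Mapping.single i 1) 1"

text \<open>
  The map \<open>h\<close> embeds the coefficients into the ring of values; it is the identity for evaluation
  at a point, and \<open>\<lambda>c. [:c:]\<close> for substituting univariate polynomials.
\<close>

definition mp_subst ::
  "('a::zero \<Rightarrow> 'b::comm_semiring_1) \<Rightarrow> ('v::finite \<Rightarrow> 'b) \<Rightarrow> ('v, 'a) mpoly \<Rightarrow> 'b" where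
  "mp_subst h x g =
     (\<Sum>m \<in> Poly_Mapping.keys g.
        h (Poly_Mapping.lookup g m) * (\<Prod>i\<in>UNIV. x i ^ Poly_Mapping.lookup m i))"

definition mp_eval :: "('v::finite, 'a::comm_semiring_1) mpoly \<Rightarrow> 'a ^ 'v \<Rightarrow> 'a" where
  "mp_eval g x = mp_subst (\<lambda>c. c) (\<lambda>i. x $ i) g"

definition mp_pderiv :: "'v \<Rightarrow> ('v, 'a::comm_semiring_1) mpoly \<Rightarrow> ('v, 'a) mpoly" where
  "mp_pderiv i g =
     (\<Sum>m \<in> Poly_Mapping.keys g.
        Poly_Mapping.single (m - Poly_Mapping.single i 1)
          (of_nat (Poly_Mapping.lookup m i) * Poly_Mapping.lookup g m))"

definition homogeneous :: "('v::finite, 'a::zero) mpoly \<Rightarrow> bool" where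
  "homogeneous g \<longleftrightarrow>
     (\<exists>d. \<forall>m \<in> Poly_Mapping.keys g. (\<Sum>i\<in>UNIV. Poly_Mapping.lookup m i) = d)"

text \<open>
  Points and lines of the projective space on \<open>'a ^ 'v\<close> are the subspaces of dimension 1 and 2;
  incidence is inclusion.
\<close>

definition proj_points :: "('a::field ^ 'v::finite) set set" where
  "proj_points = {P. vec.subspace P \<and> vec.dim P = 1}"

definition proj_lines :: "('a::field ^ 'v::finite) set set" where
  "proj_lines = {L. vec.subspace L \<and> vec.dim L = 2}"

text \<open>
  For homogeneous \<open>g\<close>, vanishing does not depend on the vector chosen to represent a point.
\<close>

definition vanishes_at :: "('v::finite, 'a::field) mpoly \<Rightarrow> ('a ^ 'v) set \<Rightarrow> bool" where
  "vanishes_at g P \<longleftrightarrow> (\<forall>p\<in>P. p \<noteq> 0 \<longrightarrow> mp_eval g p = 0)"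

definition variety :: "('v::finite, 'a::field) mpoly set \<Rightarrow> ('a ^ 'v) set set" where
  "variety G = {P \<in> proj_points. \<forall>g\<in>G. vanishes_at g P}"

text \<open>
  The coordinates \<open>X\<^sub>0, \<dots>, X\<^sub>3\<close> are indexed by the elements \<open>0, 1, 2, 3\<close> of the
  numeral type \<open>4\<close>.
\<close>

definition vec4 :: "'a \<Rightarrow> 'a \<Rightarrow> 'a \<Rightarrow> 'a \<Rightarrow> 'a ^ 4" where
  "vec4 a b c d = (\<chi> i. if i = 0 then a else if i = 1 then b else if i = 2 then c else d)"

lemma vec4_nth [simp]:
  "vec4 a b c d $ 0 = a" "vec4 a b c d $ 1 = b" "vec4 a b c d $ 2 = c" "vec4 a b c d $ 3 = d"
  by (simp_all add: vec4_def)

definition cayley_poly :: "(4, 'a::field) mpoly" where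
  "cayley_poly = Var 0 * Var 1 * Var 2 - Var 1 ^ 3 - Var 0 ^ 2 * Var 3"

definition cayley_surface :: "('a::field ^ 4) set set" where
  "cayley_surface = variety {cayley_poly}"

definition simple_points :: "('a::field ^ 4) set set" where
  "simple_points =
     {P \<in> cayley_surface. \<not> (\<forall>i. vanishes_at (mp_pderiv i cayley_poly) P)}"

definition generators :: "('a::field ^ 4) set set" where
  "generators =
     {vec.span {vec4 (s0 ^ 2) (s0 * s1) (s1 ^ 2) 0, vec4 0 0 s0 s1} | s0 s1. (s0, s1) \<noteq> (0, 0)}"

definition osculating_tangent_at :: "('a::field ^ 4) set \<Rightarrow> ('a ^ 4) set \<Rightarrow> bool" where
  "osculating_tangent_at P t \<longleftrightarrow>
     t \<in> proj_lines \<and>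
     (\<exists>p q. P = vec.span {p} \<and> t = vec.span {p, q} \<and>
        [:0, 1:] ^ 3 dvd mp_subst (\<lambda>c. [:c:]) (\<lambda>i. [:p $ i, q $ i:]) cayley_poly)"

definition proper_osculating_tangents :: "('a::field ^ 4) set set" where
  "proper_osculating_tangents =
     {t. (\<exists>P \<in> simple_points. osculating_tangent_at P t) \<and> t \<notin> generators}"

definition g_inf :: "('a::field ^ 4) set" where
  "g_inf = {x. x $ 0 = 0 \<and> x $ 1 = 0}"

definition betten_walker :: "('a::field ^ 4) set set" where
  "betten_walker = insert g_inf proper_osculating_tangents"

datatype pluecker_index = Y01 | Y02 | Y03 | Y12 | Y13 | Y23

instance pluecker_index :: finite
proof
  have "(UNIV :: pluecker_index set) = {Y01, Y02, Y03, Y12, Y13, Y23}"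
    using pluecker_index.exhaust by auto
  then show "finite (UNIV :: pluecker_index set)"
    by (metis finite.emptyI finite.insertI)
qed

definition pluecker :: "'a::field ^ 4 \<Rightarrow> 'a ^ 4 \<Rightarrow> 'a ^ pluecker_index" where
  "pluecker p q = (\<chi> k. case k of
      Y01 \<Rightarrow> p $ 0 * q $ 1 - p $ 1 * q $ 0
    | Y02 \<Rightarrow> p $ 0 * q $ 2 - p $ 2 * q $ 0
    | Y03 \<Rightarrow> p $ 0 * q $ 3 - p $ 3 * q $ 0
    | Y12 \<Rightarrow> p $ 1 * q $ 2 - p $ 2 * q $ 1
    | Y13 \<Rightarrow> p $ 1 * q $ 3 - p $ 3 * q $ 1
    | Y23 \<Rightarrow> p $ 2 * q $ 3 - p $ 3 * q $ 2)"

definition klein :: "('a::field ^ 4) set \<Rightarrow> ('a ^ pluecker_index) set" where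
  "klein L = (THE Y. \<exists>p q. L = vec.span {p, q} \<and> Y = vec.span {pluecker p q})"

lemma span_pluecker_mono:
  fixes p q p' q' :: "'a::field ^ 4"
  assumes "vec.span {p', q'} \<subseteq> vec.span {p, q}"
  shows "vec.span {pluecker p' q'} \<subseteq> vec.span {pluecker p q}"
proof -
  have comb: "\<exists>a b. x = a *s p + b *s q" if "x \<in> vec.span {p, q}" for x
  proof -
    from that obtain a where "x - a *s p \<in> vec.span {q}"
      by (auto simp: vec.span_insert)
    then obtain b where "x - a *s p = b *s q"
      by (auto simp: vec.span_singleton)
    then have "x = a *s p + b *s q"
      by (simp add: algebra_simps)
    then show ?thesis by blast
  qed
  have "p' \<in> vec.span {p, q}" "q' \<in> vec.span {p, q}"
    using assms vec.span_base[of p' "{p', q'}"] vec.span_base[of q' "{p', q'}"] by auto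
  then obtain a b c d where p': "p' = a *s p + b *s q" and q': "q' = c *s p + d *s q"
    using comb by metis
  have "pluecker p' q' = (a * d - b * c) *s pluecker p q"
    unfolding p' q' pluecker_def vec_eq_iff
    by (auto simp: algebra_simps split: pluecker_index.split)
  then have "pluecker p' q' \<in> vec.span {pluecker p q}"
    unfolding vec.span_singleton by blast
  then show ?thesis
    by (simp add: vec.span_minimal)
qed

text \<open>The description in \<open>klein\<close> is independent of the spanning vectors.\<close>

lemma klein_span: "klein (vec.span {p, q}) = vec.span {pluecker p q}"
  unfolding klein_def
  by (rule the_equality) (blast, metis span_pluecker_mono subset_antisym order_refl)

definition algebraic_line_set :: "('a::field ^ 4) set set \<Rightarrow> bool" where
  "algebraic_line_set S \<longleftrightarrow>
     (\<exists>G. finite G \<and> (\<forall>g\<in>G. homogeneous g) \<and> klein ` S = variety G)"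

end

theory Submission
  imports Defs "HOL-Algebra.Algebraic_Closure_Type"
begin

no_notation fps_nth (infixl \<open>$\<close> 75)

text \<open>
  The proper osculating tangent at \<open>P(u, v)\<close> has Pluecker coordinates
  \<open>(1, 3u, v, 3u\<^sup>2 - v, u\<^sup>3, v\<^sup>2 - 3u\<^sup>2v + 3u\<^sup>4)\<close>. A form \<open>g\<close> of degree \<open>d\<close> vanishing at all
  these points vanishes, since \<open>K\<close> is infinite, also for parameters in the algebraic closure of
  \<open>K\<close>. There pick a root \<open>w\<close> of \<open>w\<^sup>2 - 3w + 3\<close> and put \<open>v = wu\<^sup>2\<close>, which kills the last
  coordinate. The entry \<open>u\<^sup>3\<close> then has the highest degree in \<open>u\<close>, so the coefficient of
  \<open>u\<^bsup>3d\<^esup>\<close> in \<open>g\<close> is the coefficient of \<open>Y\<^sub>1\<^sub>3\<^sup>d\<close>, which is therefore zero. Hence the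
  \<open>K\<close>-rational point \<open>K(0,0,0,0,1,0)\<close> belongs to every variety containing the image of the
  spread; but it is not itself in that image.
\<close>

section \<open>Evaluation and differentiation of polynomials\<close>

text \<open>A ring homomorphism may be moved inside the sum of monomials. It is applied to
  evaluation of univariate polynomials at \<open>z\<close>, alone or after mapping their
  coefficients to the algebraic closure.\<close>

lemma mp_subst_hom:
  assumes "\<phi> 0 = 0" "\<phi> 1 = 1" "\<And>a b. \<phi> (a + b) = \<phi> a + \<phi> b" "\<And>a b. \<phi> (a * b) = \<phi> a * \<phi> b"
  shows "\<phi> (mp_subst h x g) = mp_subst (\<lambda>c. \<phi> (h c)) (\<lambda>i. \<phi> (x i)) g"
proof -
  have sum: "\<phi> (sum f A) = (\<Sum>a\<in>A. \<phi> (f a))" for f :: "'e \<Rightarrow> 'b" and A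
    by (induction A rule: infinite_finite_induct) (auto simp: assms)
  have prod: "\<phi> (prod f A) = (\<Prod>a\<in>A. \<phi> (f a))" for f :: "'e \<Rightarrow> 'b" and A
    by (induction A rule: infinite_finite_induct) (auto simp: assms)
  have power: "\<phi> (a ^ n) = \<phi> a ^ n" for a n
    by (induction n) (auto simp: assms)
  show ?thesis
    by (simp add: mp_subst_def sum prod power assms)
qed

text \<open>Extra exponent vectors have coefficient zero. Cancellation can make the support of a
  difference smaller than the union of the supports, so a common index set \<open>S\<close> is
  needed to compare sums termwise.\<close>

lemma mp_subst_superset:
  assumes "h 0 = 0" "finite S" "Poly_Mapping.keys g \<subseteq> S"
  shows "mp_subst h x g =
    (\<Sum>m\<in>S. h (Poly_Mapping.lookup g m) * (\<Prod>i\<in>UNIV. x i ^ Poly_Mapping.lookup m i))"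
  unfolding mp_subst_def
  using assms by (intro sum.mono_neutral_left) (auto simp: in_keys_iff)

lemma mp_subst_diff:
  fixes g g' :: "('v::finite, 'a::ring) mpoly" and h :: "'a \<Rightarrow> 'b::comm_ring_1"
  assumes "h 0 = 0" "\<And>a b. h (a - b) = h a - h b"
  shows "mp_subst h x (g - g') = mp_subst h x g - mp_subst h x g'"
proof -
  let ?S = "Poly_Mapping.keys g \<union> Poly_Mapping.keys g'"
  have "Poly_Mapping.keys (g - g') \<subseteq> ?S"
    by (auto simp: in_keys_iff lookup_minus)
  then show ?thesis
    by (simp add: mp_subst_superset[of h ?S] assms lookup_minus sum_subtractf left_diff_distrib)
qed

lemma mp_subst_single:
  assumes "h 0 = 0"
  shows "mp_subst h x (Poly_Mapping.single m c) = h c * (\<Prod>i\<in>UNIV. x i ^ Poly_Mapping.lookup m i)"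
  by (simp add: mp_subst_def assms)

lemma mp_pderiv_superset:
  assumes "finite S" "Poly_Mapping.keys g \<subseteq> S"
  shows "mp_pderiv i g = (\<Sum>m\<in>S. Poly_Mapping.single (m - Poly_Mapping.single i 1)
          (of_nat (Poly_Mapping.lookup m i) * Poly_Mapping.lookup g m))"
  unfolding mp_pderiv_def
  using assms by (intro sum.mono_neutral_left) (auto simp: in_keys_iff)

lemma mp_pderiv_diff:
  fixes g g' :: "('v, 'a::comm_ring_1) mpoly"
  shows "mp_pderiv i (g - g') = mp_pderiv i g - mp_pderiv i g'"
proof -
  let ?S = "Poly_Mapping.keys g \<union> Poly_Mapping.keys g'"
  have "Poly_Mapping.keys (g - g') \<subseteq> ?S"
    by (auto simp: in_keys_iff lookup_minus)
  then show ?thesis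
    by (simp add: mp_pderiv_superset[of ?S] lookup_minus sum_subtractf right_diff_distrib
          single_diff)
qed

lemma mp_pderiv_single:
  "mp_pderiv i (Poly_Mapping.single m c) =
     Poly_Mapping.single (m - Poly_Mapping.single i 1) (of_nat (Poly_Mapping.lookup m i) * c)"
  by (simp add: mp_pderiv_def)

section \<open>Pure powers of one variable in a form\<close>

lemma prod_power_lookup_single:
  "(\<Prod>i\<in>(UNIV :: 'v::finite set). x i ^ Poly_Mapping.lookup (Poly_Mapping.single j d) i) = x j ^ d"
  by (simp add: lookup_single when_def if_distrib cong: if_cong)

lemma eq_single_if_supported:
  fixes m :: "'v::finite \<Rightarrow>\<^sub>0 nat"
  assumes "\<And>i. i \<noteq> j \<Longrightarrow> Poly_Mapping.lookup m i = 0" "(\<Sum>i\<in>UNIV. Poly_Mapping.lookup m i) = d"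
  shows "m = Poly_Mapping.single j d"
proof -
  have "d = Poly_Mapping.lookup m j"
    using assms by (simp add: sum.remove[of UNIV j])
  then show ?thesis
    using assms(1) by (intro poly_mapping_eqI) (auto simp: lookup_single when_def)
qed

text \<open>A monomial containing a variable other than the \<open>j\<close>-th vanishes at
  \<open>axis j c\<close>; in degree \<open>d\<close> only the pure power of the \<open>j\<close>-th
  variable is left.\<close>

lemma mp_eval_axis:
  fixes g :: "('v::finite, 'a::field) mpoly"
  assumes "\<And>m. m \<in> Poly_Mapping.keys g \<Longrightarrow> (\<Sum>i\<in>UNIV. Poly_Mapping.lookup m i) = d"
  shows "mp_eval g (axis j c) = Poly_Mapping.lookup g (Poly_Mapping.single j d) * c ^ d"
proof -
  have "(\<Prod>i\<in>UNIV. axis j c $ i ^ Poly_Mapping.lookup m i) =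
      (if m = Poly_Mapping.single j d then c ^ d else 0)" if "m \<in> Poly_Mapping.keys g" for m
  proof (cases "\<exists>i. i \<noteq> j \<and> Poly_Mapping.lookup m i \<noteq> 0")
    case True
    then obtain i where i: "i \<noteq> j" "Poly_Mapping.lookup m i \<noteq> 0" by blast
    then have "m \<noteq> Poly_Mapping.single j d"
      by (auto simp: lookup_single)
    moreover have "(\<Prod>i\<in>UNIV. axis j c $ i ^ Poly_Mapping.lookup m i) = 0"
      using i by (intro prod_zero) (auto simp: axis_def intro!: bexI[of _ i])
    ultimately show ?thesis by simp
  next
    case False
    then have "m = Poly_Mapping.single j d"
      using assms[OF that] by (intro eq_single_if_supported) auto
    then show ?thesis
      by (simp add: prod_power_lookup_single)
  qed
  then have "mp_eval g (axis j c) = (\<Sum>m\<in>Poly_Mapping.keys g.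
      Poly_Mapping.lookup g m * (if m = Poly_Mapping.single j d then c ^ d else 0))"
    unfolding mp_eval_def mp_subst_def by (intro sum.cong) simp_all
  then show ?thesis
    by (simp add: if_distrib in_keys_iff cong: if_cong split: if_splits)
qed

text \<open>A monomial \<open>m\<close> of degree \<open>d\<close> becomes a multiple of the power
  of T with exponent the weighted degree of \<open>m\<close>. As \<open>wt j\<close> is strictly the
  largest weight, this exponent reaches \<open>wt j * d\<close> only for the pure power of the
  \<open>j\<close>-th variable.\<close>

lemma coeff_mp_subst_monom:
  fixes g :: "('v::finite, 'a::zero) mpoly" and h :: "'a \<Rightarrow> 'b::comm_ring_1"
  assumes deg: "\<And>m. m \<in> Poly_Mapping.keys g \<Longrightarrow> (\<Sum>i\<in>UNIV. Poly_Mapping.lookup m i) = d"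
    and "h 0 = 0" and wt: "\<And>i. i \<noteq> j \<Longrightarrow> wt i < wt j" and "a j = 1"
  shows "Polynomial.coeff (mp_subst (\<lambda>c. [:h c:]) (\<lambda>i. Polynomial.monom (a i) (wt i)) g) (wt j * d) =
    h (Poly_Mapping.lookup g (Poly_Mapping.single j d))"
proof -
  have prod_monom: "(\<Prod>i\<in>A. Polynomial.monom (a i) (wt i) ^ f i) =
      Polynomial.monom (\<Prod>i\<in>A. a i ^ f i) (\<Sum>i\<in>A. wt i * f i)" for A :: "'v set" and f
    by (induction A rule: infinite_finite_induct) (auto simp: monom_power mult_monom)
  have "Polynomial.coeff (\<Prod>i\<in>UNIV. Polynomial.monom (a i) (wt i) ^ Poly_Mapping.lookup m i) (wt j * d) =
      (if m = Poly_Mapping.single j d then 1 else 0)" if m: "m \<in> Poly_Mapping.keys g" for m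
  proof (cases "\<exists>i. i \<noteq> j \<and> Poly_Mapping.lookup m i \<noteq> 0")
    case True
    then obtain i where i: "i \<noteq> j" "Poly_Mapping.lookup m i \<noteq> 0" by blast
    then have "m \<noteq> Poly_Mapping.single j d"
      by (auto simp: lookup_single)
    moreover have "(\<Sum>i\<in>UNIV. wt i * Poly_Mapping.lookup m i) <
        (\<Sum>i\<in>UNIV. wt j * Poly_Mapping.lookup m i)"
    proof (rule sum_strict_mono_ex1)
      show "\<forall>i\<in>UNIV. wt i * Poly_Mapping.lookup m i \<le> wt j * Poly_Mapping.lookup m i"
        using wt by (metis less_imp_le mult_le_mono1 order_refl)
      show "\<exists>i\<in>UNIV. wt i * Poly_Mapping.lookup m i < wt j * Poly_Mapping.lookup m i"
        using i wt[of i] by (intro bexI[of _ i]) auto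
    qed simp
    then have "(\<Sum>i\<in>UNIV. wt i * Poly_Mapping.lookup m i) \<noteq> wt j * d"
      using deg[OF m] by (simp flip: sum_distrib_left)
    ultimately show ?thesis by (simp add: prod_monom)
  next
    case False
    then have m: "m = Poly_Mapping.single j d"
      using deg[OF m] by (intro eq_single_if_supported) auto
    then show ?thesis
      unfolding m prod_power_lookup_single
      using \<open>a j = 1\<close> by (simp add: monom_power)
  qed
  then have "Polynomial.coeff (mp_subst (\<lambda>c. [:h c:]) (\<lambda>i. Polynomial.monom (a i) (wt i)) g) (wt j * d) =
      (\<Sum>m\<in>Poly_Mapping.keys g.
        h (Poly_Mapping.lookup g m) * (if m = Poly_Mapping.single j d then 1 else 0))"
    unfolding mp_subst_def coeff_sum by (intro sum.cong) simp_all
  then show ?thesis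
    using \<open>h 0 = 0\<close> by (simp add: if_distrib in_keys_iff cong: if_cong split: if_splits)
qed

section \<open>Forms vanishing on the image of the spread\<close>

text \<open>Any commutative ring is allowed, so that the parameters can be elements of K,
  polynomials, or elements of the algebraic closure.\<close>

definition osc_coords :: "'a::comm_ring_1 \<Rightarrow> 'a \<Rightarrow> pluecker_index \<Rightarrow> 'a" where
  "osc_coords u v k = (case k of Y01 \<Rightarrow> 1 | Y02 \<Rightarrow> 3 * u | Y03 \<Rightarrow> v | Y12 \<Rightarrow> 3 * u ^ 2 - v
     | Y13 \<Rightarrow> u ^ 3 | Y23 \<Rightarrow> v ^ 2 - 3 * u ^ 2 * v + 3 * u ^ 4)"

section \<open>Passage to the algebraic closure\<close>

lemma poly_osc_coords: "poly (osc_coords p q k) z = osc_coords (poly p z) (poly q z) k"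
  by (simp add: osc_coords_def split: pluecker_index.split)

lemma poly_mp_subst:
  "poly (mp_subst h x g) z = mp_subst (\<lambda>c. poly (h c) z) (\<lambda>i. poly (x i) z) g"
  by (rule mp_subst_hom) auto

lemma map_poly_to_ac_hom:
  "map_poly to_ac (p + q) = map_poly to_ac p + map_poly to_ac q"
  "map_poly to_ac (p - q) = map_poly to_ac p - map_poly to_ac q"
  "map_poly to_ac (p * q) = map_poly to_ac p * map_poly to_ac q"
  by (auto intro!: poly_eqI simp: coeff_map_poly coeff_mult to_ac_sum)

lemma map_poly_to_ac_power: "map_poly to_ac (p ^ n) = map_poly to_ac p ^ n"
  by (induction n) (auto simp: map_poly_to_ac_hom map_poly_1)

lemma poly_mp_subst_to_ac:
  "poly (map_poly to_ac (mp_subst h x g)) z =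
     mp_subst (\<lambda>c. poly (map_poly to_ac (h c)) z) (\<lambda>i. poly (map_poly to_ac (x i)) z) g"
  by (rule mp_subst_hom) (auto simp: map_poly_to_ac_hom map_poly_1)

lemma map_poly_to_ac_osc_coords:
  "map_poly to_ac (osc_coords p q k) = osc_coords (map_poly to_ac p) (map_poly to_ac q) k"
proof -
  have "map_poly to_ac (3 :: 'a poly) = 3"
    using map_poly_pCons[of to_ac "3::'a" 0] by (simp add: numeral_poly)
  then show ?thesis
    by (simp add: osc_coords_def map_poly_to_ac_hom map_poly_to_ac_power map_poly_1
        split: pluecker_index.split)
qed

lemma poly_eq_0_if_infinite_roots:
  fixes p :: "'a::idom poly"
  assumes "infinite A" "\<And>x. x \<in> A \<Longrightarrow> poly p x = 0"
  shows "p = 0"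
proof (rule ccontr)
  assume "p \<noteq> 0"
  then have "finite {x. poly p x = 0}" by (rule poly_roots_finite)
  then show False
    using assms finite_subset[of A "{x. poly p x = 0}"] by blast
qed

lemma coeff_Y13_eq_0:
  fixes g :: "(pluecker_index, 'a::field) mpoly"
  assumes inf: "infinite (UNIV :: 'a set)"
    and deg: "\<And>m. m \<in> Poly_Mapping.keys g \<Longrightarrow> (\<Sum>i\<in>UNIV. Poly_Mapping.lookup m i) = d"
    and van: "\<And>u v. mp_subst (\<lambda>c. c) (osc_coords u v) g = 0"
  shows "Poly_Mapping.lookup g (Poly_Mapping.single Y13 d) = 0"
proof -
  \<comment> \<open>Only the second parameter has to leave K: \<open>w\<close> may lie outside K,
    but \<open>u\<close> in K already supplies infinitely many roots for \<open>?R\<close> below.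
    For fixed \<open>u\<close> the form is a polynomial \<open>?Q\<close> in the second parameter,
    zero on all of K, hence zero.\<close>
  have van_ac: "mp_subst to_ac (osc_coords (to_ac u) z) g = 0" for u z
  proof -
    let ?Q = "mp_subst (\<lambda>c. [:c:]) (osc_coords [:u:] [:0, 1:]) g"
    have "?Q = 0"
      by (rule poly_eq_0_if_infinite_roots[OF inf])
        (simp add: poly_mp_subst poly_osc_coords van)
    then have "poly (map_poly to_ac ?Q) z = 0" by simp
    then show ?thesis
      by (simp add: poly_mp_subst_to_ac map_poly_to_ac_osc_coords poly_osc_coords map_poly_pCons)
  qed
  \<comment> \<open>At \<open>v = w * u ^ 2\<close> the coordinate Y23 equals
    \<open>(w ^ 2 - 3 * w + 3) * u ^ 4\<close>, whose degree would exceed that of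
    \<open>u ^ 3\<close>; the choice of \<open>w\<close> removes it.\<close>
  obtain w :: "'a alg_closure" where "poly [:3, -3, 1:] w = 0"
    using alg_closed_imp_poly_has_root[of "[:3, -3, 1 :: 'a alg_closure:]"] by auto
  then have w: "w ^ 2 - 3 * w + 3 = 0"
    by (simp add: algebra_simps power2_eq_square)
  \<comment> \<open>At the parameters \<open>u\<close> and \<open>w * u ^ 2\<close> the coordinate
    \<open>k\<close> is the monomial \<open>a k * u ^ wt k\<close>. Since Y23 is zero there, its
    weight may be any number below 3.\<close>
  define a where "a k = (case k of Y01 \<Rightarrow> 1 | Y02 \<Rightarrow> 3 | Y03 \<Rightarrow> w | Y12 \<Rightarrow> 3 - w
     | Y13 \<Rightarrow> 1 | Y23 \<Rightarrow> 0)" for k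
  define wt :: "pluecker_index \<Rightarrow> nat" where "wt k = (case k of Y01 \<Rightarrow> 0 | Y02 \<Rightarrow> 1 | Y03 \<Rightarrow> 2 | Y12 \<Rightarrow> 2
     | Y13 \<Rightarrow> 3 | Y23 \<Rightarrow> 0)" for k
  let ?R = "mp_subst (\<lambda>c. [:to_ac c:]) (\<lambda>k. Polynomial.monom (a k) (wt k)) g"
  have "poly (Polynomial.monom (a k) (wt k)) u = osc_coords u (w * u ^ 2) k" for k u
  proof -
    have "(w * u ^ 2) ^ 2 - 3 * u ^ 2 * (w * u ^ 2) + 3 * u ^ 4 = (w ^ 2 - 3 * w + 3) * u ^ 4"
      by (simp add: algebra_simps power2_eq_square power4_eq_xxxx)
    then have "(w * u ^ 2) ^ 2 - 3 * u ^ 2 * (w * u ^ 2) + 3 * u ^ 4 = 0"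
      by (simp only: w mult_zero_left)
    then show ?thesis
      by (cases k) (simp_all add: a_def wt_def osc_coords_def poly_monom left_diff_distrib)
  qed
  then have R: "poly ?R u = mp_subst to_ac (osc_coords u (w * u ^ 2)) g" for u
    by (simp add: poly_mp_subst)
  have "?R = 0"
  proof (rule poly_eq_0_if_infinite_roots)
    show "infinite (range to_ac :: 'a alg_closure set)"
      using inf inj_to_ac by (metis finite_imageD)
    show "poly ?R u = 0" if "u \<in> range to_ac" for u
      unfolding R using that van_ac by auto
  qed
  moreover have "Polynomial.coeff ?R (wt Y13 * d) =
      to_ac (Poly_Mapping.lookup g (Poly_Mapping.single Y13 d))"
  proof (rule coeff_mp_subst_monom[OF deg])
    show "wt i < wt Y13" if "i \<noteq> Y13" for i
      using that by (cases i) (auto simp: wt_def)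
  qed (auto simp: a_def)
  ultimately show ?thesis by simp
qed

section \<open>The osculating tangents of the Cayley surface\<close>

lemma prod_UNIV_4: "prod f (UNIV :: 4 set) = f 0 * f 1 * f 2 * f 3"
  for f :: "4 \<Rightarrow> 'a::comm_monoid_mult"
proof -
  \<comment> \<open>Numerals of type \<open>4\<close> are read modulo 4, so the element
    \<open>4\<close> listed in \<open>UNIV_4\<close> is the index \<open>0\<close>.\<close>
  have "(4::4) = 0" by simp
  then have UNIV_eq: "(UNIV :: 4 set) = {0, 1, 2, 3}"
    unfolding UNIV_4 by auto
  show ?thesis
    unfolding UNIV_eq by (simp add: mult.assoc)
qed

text \<open>A difference of single terms is the form to which the rules for substitution and
  differentiation of single terms apply.\<close>

lemma cayley_poly_eq:
  "cayley_poly =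
     Poly_Mapping.single (Poly_Mapping.single 0 1 + Poly_Mapping.single 1 1 + Poly_Mapping.single 2 1) 1
   - Poly_Mapping.single (Poly_Mapping.single 1 3) 1
   - Poly_Mapping.single (Poly_Mapping.single 0 2 + Poly_Mapping.single 3 1) (1::'a::field)"
proof -
  have "Var i ^ n = Poly_Mapping.single (Poly_Mapping.single i n) (1::'a)" for i :: 4 and n
    by (induction n) (simp_all add: Var_def mult_single flip: single_add)
  from this[of 1 3] this[of 0 2] show ?thesis
    unfolding cayley_poly_def by (simp only: Var_def mult_single mult_1_left)
qed

lemma mp_subst_cayley_poly:
  fixes h :: "'a::field \<Rightarrow> 'b::comm_ring_1"
  assumes "h 0 = 0" "h 1 = 1" "\<And>a b. h (a - b) = h a - h b"
  shows "mp_subst h x cayley_poly = x 0 * x 1 * x 2 - x 1 ^ 3 - x 0 ^ 2 * x 3"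
  by (simp add: cayley_poly_eq mp_subst_diff mp_subst_single assms prod_UNIV_4
        lookup_add lookup_single power_add del: single_numeral single_one)

lemma mp_eval_cayley_poly:
  fixes x :: "'a::field ^ 4"
  shows "mp_eval cayley_poly x = x $ 0 * x $ 1 * x $ 2 - x $ 1 ^ 3 - x $ 0 ^ 2 * x $ 3"
  by (simp add: mp_eval_def mp_subst_cayley_poly)

lemma mp_eval_pderiv_cayley_poly:
  fixes x :: "'a::field ^ 4"
  shows "mp_eval (mp_pderiv i cayley_poly) x =
     (if i = 0 then x $ 1 * x $ 2 - 2 * x $ 0 * x $ 3
      else if i = 1 then x $ 0 * x $ 2 - 3 * x $ 1 ^ 2
      else if i = 2 then x $ 0 * x $ 1
      else - (x $ 0 ^ 2))"
proof -
  have "i = 0 \<or> i = 1 \<or> i = 2 \<or> i = 3"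
    using exhaust_4[of i] by auto
  then show ?thesis
    by (elim disjE) (simp_all add: cayley_poly_eq mp_pderiv_diff mp_pderiv_single mp_eval_def
        mp_subst_diff mp_subst_single prod_UNIV_4 lookup_add lookup_minus lookup_single
        del: single_numeral single_one flip: single_uminus)
qed

section \<open>Simple points and lines through them\<close>

lemma span_singleton_mem_proj_points:
  fixes p :: "'a::field ^ 'v::finite"
  assumes "p \<noteq> 0"
  shows "vec.span {p} \<in> proj_points"
  using assms by (simp add: proj_points_def vec.dim_span_eq_card_independent)

text \<open>In the plane X0 = 0 the cubic reduces to -X1^3, so a point of the surface there has X1 =
  0 as well, and then all four partial derivatives vanish.\<close>

lemma simple_point_nth_0:
  fixes p :: "'a::field ^ 4"
  assumes "vec.span {p} \<in> simple_points"
  shows "p $ 0 \<noteq> 0"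
proof
  assume p0: "p $ 0 = 0"
  from assms obtain i p' where p': "p' \<in> vec.span {p}" "p' \<noteq> 0"
      "mp_eval (mp_pderiv i cayley_poly) p' \<noteq> 0" "mp_eval cayley_poly p' = 0"
    by (auto simp: simple_points_def cayley_surface_def variety_def vanishes_at_def)
  have "p' $ 0 = 0"
    using p'(1) p0 by (auto simp: vec.span_singleton)
  moreover from this have "p' $ 1 = 0"
    using p'(4) by (simp add: mp_eval_cayley_poly)
  ultimately show False
    using p'(3) by (simp add: mp_eval_pderiv_cayley_poly split: if_splits)
qed

text \<open>These minors express that \<open>q\<close> is the multiple of \<open>p\<close> by
  \<open>q $ 0 / p $ 0\<close>. Thus a line through a point off the plane X0 = 0 has some nonzero
  coordinate among Y01, Y02, Y03.\<close>

lemma pluecker_nth_0j_eq_0: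
  fixes p q :: "'a::field ^ 4"
  assumes "p $ 0 \<noteq> 0" "pluecker p q $ Y01 = 0" "pluecker p q $ Y02 = 0" "pluecker p q $ Y03 = 0"
  shows "q \<in> vec.span {p}"
proof -
  have "q $ i * p $ 0 = q $ 0 * p $ i" for i
  proof -
    have "i = 0 \<or> i = 1 \<or> i = 2 \<or> i = 3"
      using exhaust_4[of i] by auto
    then show ?thesis
      using assms by (elim disjE) (simp_all add: pluecker_def mult.commute)
  qed
  then have "q $ i = q $ 0 / p $ 0 * p $ i" for i
    using \<open>p $ 0 \<noteq> 0\<close> by (simp add: eq_divide_eq)
  then have "q = (q $ 0 / p $ 0) *s p"
    unfolding vec_eq_iff vector_smult_component by blast
  then show ?thesis
    unfolding vec.span_singleton by blast
qed

section \<open>The osculating tangent at P(u, v)\<close>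

definition cayley_point :: "'a::field \<Rightarrow> 'a \<Rightarrow> 'a ^ 4" where
  "cayley_point u v = vec4 1 u v (u * v - u ^ 3)"

text \<open>For p = \<open>cayley_point u v\<close> and q = (0, 1, b, c), the cubic at p + Tq is (v
  + ub - 3u^2 - c)T + (b - 3u)T^2 - T^3. Divisibility by T^3 forces b = 3u and c = v.\<close>

definition osc_direction :: "'a::field \<Rightarrow> 'a \<Rightarrow> 'a ^ 4" where
  "osc_direction u v = vec4 0 1 (3 * u) v"

lemma pluecker_osc: "pluecker (cayley_point u v) (osc_direction u v) $ k = osc_coords u v k"
  by (auto simp: pluecker_def cayley_point_def osc_direction_def osc_coords_def algebra_simps
      power2_eq_square power3_eq_cube power4_eq_xxxx split: pluecker_index.split)

lemma cayley_point_simple: "vec.span {cayley_point u v} \<in> simple_points"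
proof -
  have ne: "cayley_point u v \<noteq> 0"
    by (metis cayley_point_def vec4_nth(1) zero_index zero_neq_one)
  have "vanishes_at cayley_poly (vec.span {cayley_point u v})"
    by (auto simp: vanishes_at_def vec.span_singleton mp_eval_cayley_poly cayley_point_def
        algebra_simps power2_eq_square power3_eq_cube)
  moreover have "\<not> vanishes_at (mp_pderiv 3 cayley_poly) (vec.span {cayley_point u v})"
    unfolding vanishes_at_def
    using ne by (auto intro!: bexI[of _ "cayley_point u v"] vec.span_base
        simp: mp_eval_pderiv_cayley_poly cayley_point_def)
  ultimately show ?thesis
    using span_singleton_mem_proj_points[OF ne]
    by (auto simp: simple_points_def cayley_surface_def variety_def)
qed

lemma osc_tangent_mem_betten_walker:
  "vec.span {cayley_point u v, osc_direction u v} \<in> betten_walker"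
proof -
  let ?p = "cayley_point u v" and ?q = "osc_direction u v"
  let ?t = "vec.span {?p, ?q}"
  have q: "?q \<noteq> 0"
    by (metis osc_direction_def vec4_nth(2) zero_index zero_neq_one)
  have p: "?p \<notin> vec.span {?q}"
  proof
    assume "?p \<in> vec.span {?q}"
    then obtain c where "?p = c *s ?q" by (auto simp: vec.span_singleton)
    then have "?p $ 0 = c * ?q $ 0" by simp
    then show False by (simp add: cayley_point_def osc_direction_def)
  qed
  have "?p \<noteq> ?q" using p vec.span_base[of ?q "{?q}"] by auto
  moreover have "vec.independent {?p, ?q}"
    using p q by (simp add: vec.independent_insert)
  ultimately have line: "?t \<in> proj_lines"
    by (simp add: proj_lines_def vec.dim_eq_card_independent)
  have cubic: "mp_subst (\<lambda>c. [:c:]) (\<lambda>i. [:?p $ i, ?q $ i:]) cayley_poly = [:0, 1:] ^ 3 * [:-1:]"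
    by (simp add: mp_subst_cayley_poly cayley_point_def osc_direction_def
        power2_eq_square power3_eq_cube)
  have "[:0, 1:] ^ 3 dvd mp_subst (\<lambda>c. [:c:]) (\<lambda>i. [:?p $ i, ?q $ i:]) cayley_poly"
    unfolding cubic by (rule dvd_triv_left)
  then have "osculating_tangent_at (vec.span {?p}) ?t"
    using line unfolding osculating_tangent_at_def by blast
  moreover have "?t \<notin> generators"
  proof
    assume "?t \<in> generators"
    then obtain s0 s1 where t: "?t = vec.span {vec4 (s0 ^ 2) (s0 * s1) (s1 ^ 2) 0, vec4 0 0 s0 s1}"
      by (auto simp: generators_def)
    have "?q \<in> vec.span {vec4 (s0 ^ 2) (s0 * s1) (s1 ^ 2) 0, vec4 0 0 s0 s1}"
      unfolding t[symmetric] by (simp add: vec.span_base)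
    then obtain a where "?q - a *s vec4 (s0 ^ 2) (s0 * s1) (s1 ^ 2) 0 \<in> vec.span {vec4 0 0 s0 s1}"
      by (auto simp: vec.span_insert)
    then obtain b where
      "?q - a *s vec4 (s0 ^ 2) (s0 * s1) (s1 ^ 2) 0 = b *s vec4 0 0 s0 s1"
      by (auto simp: vec.span_singleton)
    then have "(?q - a *s vec4 (s0 ^ 2) (s0 * s1) (s1 ^ 2) 0) $ i = (b *s vec4 0 0 s0 s1) $ i" for i
      by simp
    \<comment> \<open>Entry 0 gives \<open>a * s0 ^ 2 = 0\<close>, hence
      \<open>a * s0 * s1 = 0\<close>, whereas entry 1 requires this product to be 1.\<close>
    from this[of 0] this[of 1] show False
      by (auto simp: osc_direction_def)
  qed
  ultimately show ?thesis
    using cayley_point_simple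
    unfolding betten_walker_def proper_osculating_tangents_def by blast
qed

section \<open>A point outside the Klein image of the spread\<close>

lemma g_inf_eq_span: "g_inf = vec.span {axis 2 1, axis 3 (1::'a::field)}"
proof
  show "vec.span {axis 2 1, axis 3 (1::'a)} \<subseteq> g_inf"
    by (intro vec.span_minimal) (auto simp: g_inf_def vec.subspace_def axis_def)
  show "g_inf \<subseteq> vec.span {axis 2 1, axis 3 (1::'a)}"
  proof
    fix x :: "'a ^ 4"
    assume x: "x \<in> g_inf"
    have "x $ i = (x $ 2 *s axis 2 1 + x $ 3 *s axis 3 1) $ i" for i
    proof -
      have "i = 0 \<or> i = 1 \<or> i = 2 \<or> i = 3"
        using exhaust_4[of i] by auto
      then show ?thesis
        using x by (auto simp: g_inf_def axis_def)
    qed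
    then have "x = x $ 2 *s axis 2 1 + x $ 3 *s axis 3 1"
      unfolding vec_eq_iff by blast
    also have "\<dots> \<in> vec.span {axis 2 1, axis 3 1}"
      by (intro vec.span_add vec.span_scale vec.span_base) auto
    finally show "x \<in> vec.span {axis 2 1, axis 3 1}" .
  qed
qed

text \<open>The image of \<open>g_inf\<close> has Y13 = 0. A proper osculating tangent passes
  through a simple point, hence leaves the plane X0 = 0, and so has a nonzero coordinate among Y01,
  Y02, Y03.\<close>

lemma axis_Y13_notin_klein_betten_walker:
  "vec.span {axis Y13 (1::'a::field)} \<notin> klein ` betten_walker"
proof
  assume "vec.span {axis Y13 (1::'a)} \<in> klein ` betten_walker"
  then obtain t :: "('a ^ 4) set"
    where t: "t \<in> betten_walker" "klein t = vec.span {axis Y13 1}" by auto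
  from t(1) consider "t = g_inf" | "t \<in> proper_osculating_tangents"
    by (auto simp: betten_walker_def)
  then show False
  proof cases
    case 1
    then have "vec.span {pluecker (axis 2 1) (axis 3 1)} = vec.span {axis Y13 (1::'a)}"
      using t(2) by (simp add: g_inf_eq_span klein_span)
    then have "axis Y13 (1::'a) \<in> vec.span {pluecker (axis 2 1) (axis 3 1)}"
      by (simp add: vec.span_base)
    then obtain c :: 'a where "axis Y13 (1::'a) = c *s pluecker (axis 2 1) (axis 3 1)"
      by (auto simp: vec.span_singleton)
    then have "axis Y13 (1::'a) $ Y13 = (c *s pluecker (axis 2 1) (axis 3 1)) $ Y13"
      by simp
    then show False
      by (simp add: pluecker_def axis_def)
  next
    case 2
    then obtain p q where pq: "vec.span {p} \<in> simple_points" "t \<in> proj_lines" "t = vec.span {p, q}"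
      by (auto simp: proper_osculating_tangents_def osculating_tangent_at_def)
    have "pluecker p q \<in> vec.span {axis Y13 1}"
      using t(2) unfolding pq(3) klein_span by (metis insertI1 vec.span_base)
    then obtain c where "pluecker p q = c *s axis Y13 1"
      by (auto simp: vec.span_singleton)
    then have "q \<in> vec.span {p}"
      using simple_point_nth_0[OF pq(1)]
      by (intro pluecker_nth_0j_eq_0) (auto simp: axis_def)
    then have "t = vec.span {p}"
      unfolding pq(3) insert_commute[of p q] by (rule vec.span_redundant)
    then have "vec.dim t \<le> card {p}"
      by (simp only: vec.dim_span) (rule vec.dim_le_card', simp)
    then show False
      using pq(2) by (simp add: proj_lines_def)
  qed
qed

theorem corollary4p6:
  assumes "infinite (UNIV :: 'a::field set)"
    and "CHAR('a) \<noteq> 3"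
    and "\<forall>a::'a. \<exists>!b. b ^ 3 = a"
  shows "\<not> algebraic_line_set (betten_walker :: ('a ^ 4) set set)"
proof
  assume "algebraic_line_set (betten_walker :: ('a ^ 4) set set)"
  then obtain G :: "(pluecker_index, 'a) mpoly set"
    where hom: "\<forall>g\<in>G. homogeneous g" and G: "klein ` betten_walker = variety G"
    by (auto simp: algebraic_line_set_def)
  have "vanishes_at g (vec.span {axis Y13 1})" if g: "g \<in> G" for g
  proof -
    obtain d where d: "\<And>m. m \<in> Poly_Mapping.keys g \<Longrightarrow> (\<Sum>i\<in>UNIV. Poly_Mapping.lookup m i) = d"
      using hom g by (auto simp: homogeneous_def)
    have "mp_subst (\<lambda>c. c) (osc_coords u v) g = 0" for u v
    proof -
      let ?y = "pluecker (cayley_point u v) (osc_direction u v)"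
      have "vec.span {?y} \<in> variety G"
        using osc_tangent_mem_betten_walker G klein_span by (metis imageI)
      moreover have "?y \<noteq> 0"
      proof
        assume "?y = 0"
        then have "?y $ Y01 = 0" by simp
        then show False by (simp add: pluecker_osc osc_coords_def)
      qed
      ultimately have "mp_eval g ?y = 0"
        using g by (auto simp: variety_def vanishes_at_def vec.span_base)
      then show ?thesis
        by (simp add: mp_eval_def pluecker_osc)
    qed
    then have "Poly_Mapping.lookup g (Poly_Mapping.single Y13 d) = 0"
      by (intro coeff_Y13_eq_0[OF assms(1) d])
    \<comment> \<open>\<open>vanishes_at\<close> ranges over all nonzero vectors representing the
      point, hence the arbitrary scalar \<open>c\<close>.\<close>
    then have "mp_eval g (axis Y13 c) = 0" for c
      using mp_eval_axis[of g d Y13 c, OF d] by simp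
    moreover have "c *s axis Y13 1 = axis Y13 c" for c :: 'a
      by (simp add: vec_eq_iff axis_def)
    ultimately show ?thesis
      by (auto simp: vanishes_at_def vec.span_singleton)
  qed
  then have "vec.span {axis Y13 1} \<in> variety G"
    by (auto simp: variety_def intro!: span_singleton_mem_proj_points)
  then show False
    using axis_Y13_notin_klein_betten_walker G by auto
qed

end
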